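(* For every fixed integer $\ell\ge 2$, as $n\to\infty$, $$\left(\frac{1}{(2\ell-2)^{1/2}}-o(1)\right)n^{1/2}\le m^0(n,C_{\ell,\ell})\le m^+(n,C_{\ell,\ell})\le(2\ell+o(1))n^{1/2}.$$
   Context: Digraphs have no loops and no parallel edges (opposite edges are allowed). $C_{\ell,\ell}$ is the digraph consisting of two vertices $x,y$ joined by two internally vertex-disjoint paths with $\ell$ edges each, both oriented from $x$ to $y$. A digraph is $C_{\ell,\ell}$-free if it has no subgraph isomorphic to $C_{\ell,\ell}$. $m^+(n,C_{\ell,\ell})$ (resp. $m^0(n,C_{\ell,\ell})$) is the largest possible minimum outdegree (resp. minimum semidegree $\min\{\delta^+,\delta^-\}$) of an $n$-vertex $C_{\ell,\ell}$-free digraph. *)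

theory Defs
  imports
    "Graph_Theory.Graph_Theory"
    "HOL-Library.Landau_Symbols"
    Complex_Main
begin

definition min_outdegree :: "'a pair_pre_digraph \<Rightarrow> nat" where
  "min_outdegree G = Min (out_degree (with_proj G) ` pverts G)"

definition min_indegree :: "'a pair_pre_digraph \<Rightarrow> nat" where
  "min_indegree G = Min (in_degree (with_proj G) ` pverts G)"

definition min_semidegree :: "'a pair_pre_digraph \<Rightarrow> nat" where
  "min_semidegree G = min (min_outdegree G) (min_indegree G)"

definition digraph_free :: "'b pair_pre_digraph \<Rightarrow> 'a pair_pre_digraph \<Rightarrow> bool" where
  "digraph_free F G \<longleftrightarrow>
     \<not> (\<exists>H. subgraph H (with_proj G) \<and> digraph_iso (with_proj F) H)"

text \<open>
  For \<open>j \<in> {0, 1}\<close> and \<open>i \<le> l\<close>, \<open>C_vertex l j i\<close> is the \<open>i\<close>-th vertex of the \<open>j\<close>-th path.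
  The two paths share \<open>x = 0\<close> (at \<open>i = 0\<close>) and \<open>y = l\<close> (at \<open>i = l\<close>); their inner vertices are
  \<open>1, \<dots>, l - 1\<close> and \<open>l + 1, \<dots>, 2 * l - 1\<close>.
\<close>
definition C_vertex :: "nat \<Rightarrow> nat \<Rightarrow> nat \<Rightarrow> nat" where
  "C_vertex l j i = (if i = 0 \<or> i = l then i else i + j * l)"

definition C_digraph :: "nat \<Rightarrow> nat pair_pre_digraph" where
  "C_digraph l =
     \<lparr> pverts = {C_vertex l j i | j i. j < 2 \<and> i \<le> l},
       parcs = {(C_vertex l j i, C_vertex l j (Suc i)) | j i. j < 2 \<and> i < l} \<rparr>"

text \<open>
  Taking vertices from the naturals loses no generality: every finite digraph is isomorphic to
  one of these, and all notions involved are invariant under isomorphism.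
\<close>
definition free_digraphs :: "nat \<Rightarrow> 'b pair_pre_digraph \<Rightarrow> nat pair_pre_digraph set" where
  "free_digraphs n F = {G. pair_digraph G \<and> card (pverts G) = n \<and> digraph_free F G}"

definition m_plus :: "nat \<Rightarrow> 'b pair_pre_digraph \<Rightarrow> nat" where
  "m_plus n F = Max (min_outdegree ` free_digraphs n F)"

definition m_zero :: "nat \<Rightarrow> 'b pair_pre_digraph \<Rightarrow> nat" where
  "m_zero n F = Max (min_semidegree ` free_digraphs n F)"

text \<open>
  The maxima above are over finite nonempty sets when \<open>n \<ge> 1\<close> and \<open>F = C_digraph l\<close>, \<open>l \<ge> 2\<close>.
\<close>

lemma pverts_C_digraph:
  assumes "l \<ge> 2"
  shows "pverts (C_digraph l) = {..<2 * l}"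
proof (intro set_eqI iffI)
  fix v assume "v \<in> {..<2 * l}"
  then have "v = C_vertex l (if v \<le> l then 0 else 1) (if v \<le> l then v else v - l)"
    by (auto simp: C_vertex_def)
  moreover have "(if v \<le> l then v else v - l) \<le> l"
    using \<open>v \<in> {..<2 * l}\<close> by auto
  moreover have "(if v \<le> l then 0 else 1 :: nat) < 2" by simp
  ultimately show "v \<in> pverts (C_digraph l)"
    unfolding C_digraph_def by (auto simp del: One_nat_def)
next
  fix v assume "v \<in> pverts (C_digraph l)"
  then show "v \<in> {..<2 * l}"
    using assms by (auto simp: C_digraph_def C_vertex_def less_2_cases_iff)
qed

lemma pair_digraph_C_digraph:
  assumes "l \<ge> 2"
  shows "pair_digraph (C_digraph l)"
proof -
  have sub: "parcs (C_digraph l) \<subseteq> pverts (C_digraph l) \<times> pverts (C_digraph l)"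
    by (force simp: C_digraph_def)
  have fin: "finite (pverts (C_digraph l))"
    using assms by (simp add: pverts_C_digraph)
  have "finite (parcs (C_digraph l))"
    using finite_subset[OF sub] fin by simp
  moreover have "fst e \<noteq> snd e" if "e \<in> parcs (C_digraph l)" for e
    using that assms by (auto simp: C_digraph_def C_vertex_def less_2_cases_iff split: if_splits)
  ultimately show ?thesis
    using sub fin by unfold_locales auto
qed

lemma min_outdegree_le:
  assumes "pair_digraph G" "pverts G \<noteq> {}"
  shows "min_outdegree G \<le> card (pverts G)"
proof -
  interpret pair_digraph G by fact
  obtain v where v: "v \<in> pverts G" using assms by blast
  have "min_outdegree G \<le> out_degree (with_proj G) v"
    unfolding min_outdegree_def using v pair_finite_verts by (intro Min_le) auto
  also have "\<dots> \<le> card (Pair v ` pverts G)"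
    unfolding out_degree_def out_arcs_def
    using pair_finite_verts in_arcsD2 by (intro card_mono) auto
  also have "\<dots> \<le> card (pverts G)"
    by (intro card_image_le pair_finite_verts)
  finally show ?thesis .
qed

lemma finite_min_degrees:
  assumes "n \<ge> 1"
  shows "finite (min_outdegree ` free_digraphs n F)"
    and "finite (min_semidegree ` free_digraphs n F)"
proof -
  have le: "min_outdegree G \<le> n" if "G \<in> free_digraphs n F" for G
    using that assms min_outdegree_le[of G] by (force simp: free_digraphs_def)
  then show "finite (min_outdegree ` free_digraphs n F)"
    by (intro finite_subset[OF _ finite_atMost[of n]]) auto
  show "finite (min_semidegree ` free_digraphs n F)"
    using le by (intro finite_subset[OF _ finite_atMost[of n]])
      (auto simp: min_semidegree_def min_le_iff_disj)
qed

lemma free_digraphs_C_nonempty: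
  assumes "l \<ge> 2"
  shows "free_digraphs n (C_digraph l) \<noteq> {}"
proof -
  let ?G = "\<lparr>pverts = {..<n}, parcs = {}\<rparr> :: nat pair_pre_digraph"
  have "(C_vertex l 0 0, C_vertex l 0 (Suc 0)) \<in> parcs (C_digraph l)"
    using assms by (force simp: C_digraph_def)
  then have "parcs (C_digraph l) \<noteq> {}" by blast
  then have "digraph_free (C_digraph l) ?G"
    by (auto simp: digraph_free_def digraph_iso_def subgraph_def)
  moreover have "pair_digraph ?G" by unfold_locales auto
  ultimately have "?G \<in> free_digraphs n (C_digraph l)"
    by (simp add: free_digraphs_def)
  then show ?thesis by blast
qed

end

theory Submission
  imports Defs "HOL-Number_Theory.Cong"
begin

text \<open>
  Lower bound: arrange the vertices in \<open>2l - 2\<close> cyclically ordered layers, each a copy of a grid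
  with about \<open>n / (2l - 2)\<close> cells, every arc leading to the next layer. Out of the first \<open>l - 1\<close>
  layers arcs preserve the row, out of the other \<open>l - 1\<close> layers they preserve the column. A walk
  with \<open>l\<close> arcs sees exactly one change of type in its interior, and its vertex there is
  determined by the endpoints: one coordinate comes from the start, the other from the end.
  Hence two walks with \<open>l\<close> arcs and common endpoints meet in between.

  Upper bound: if the outdegrees exceed \<open>2l \<surd>n\<close>, grow greedily a spider with \<open>t = \<lceil>\<surd>n\<rceil>\<close> legs
  with \<open>l - 1\<close> arcs directed away from the centre. Each leaf has more than \<open>\<surd>n\<close> outneighbours
  outside the spider, so two leaves share one, which closes a copy of \<open>C\<^bsub>l,l\<^esub>\<close>.
\<close>

section \<open>Subgraphs as injective homomorphisms\<close>

text \<open>Compatibility with \<open>with_proj G\<close> forces the tails and heads of a copy to be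
  \<open>fst\<close> and \<open>snd\<close>, so an isomorphism is determined on arcs by its vertex
  map. Only vertex maps matter from here on.\<close>

lemma digraph_free_iff:
  assumes "pair_wf_digraph F" "pair_wf_digraph G"
  shows "digraph_free F G \<longleftrightarrow>
    \<not> (\<exists>g. inj_on g (pverts F) \<and> g ` pverts F \<subseteq> pverts G \<and>
         (\<forall>u v. (u, v) \<in> parcs F \<longrightarrow> (g u, g v) \<in> parcs G))"
proof -
  interpret F: pair_wf_digraph F by fact
  interpret G: pair_wf_digraph G by fact
  have "(\<exists>H. subgraph H (with_proj G) \<and> digraph_iso (with_proj F) H) \<longleftrightarrow>
    (\<exists>g. inj_on g (pverts F) \<and> g ` pverts F \<subseteq> pverts G \<and>
         (\<forall>u v. (u, v) \<in> parcs F \<longrightarrow> (g u, g v) \<in> parcs G))" (is "?L \<longleftrightarrow> ?R")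
  proof
    assume ?L
    then obtain h where sub: "subgraph (app_iso h (with_proj F)) (with_proj G)"
      and iso: "pre_digraph.digraph_isomorphism (with_proj F) h"
      by (auto simp: digraph_iso_def)
    have "(iso_verts h u, iso_verts h v) \<in> parcs G" if "(u, v) \<in> parcs F" for u v
    proof -
      have "iso_arcs h (u, v) \<in> parcs G"
        using sub that by (auto simp: subgraph_def)
      moreover have "iso_tail h = fst" "iso_head h = snd"
        using sub by (auto simp: subgraph_def compatible_def)
      then have "iso_arcs h (u, v) = (iso_verts h u, iso_verts h v)"
        using iso that by (auto simp: pre_digraph.digraph_isomorphism_def prod_eq_iff)
      ultimately show ?thesis by simp
    qed
    then show ?R
      using sub iso
      by (intro exI[of _ "iso_verts h"])
        (auto simp: subgraph_def pre_digraph.digraph_isomorphism_def)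
  next
    assume ?R
    then obtain g where g: "inj_on g (pverts F)" "g ` pverts F \<subseteq> pverts G"
      "\<And>u v. (u, v) \<in> parcs F \<Longrightarrow> (g u, g v) \<in> parcs G"
      by blast
    define h where
      "h = \<lparr>iso_verts = g, iso_arcs = map_prod g g, iso_head = snd, iso_tail = fst\<rparr>"
    have "parcs F \<subseteq> pverts F \<times> pverts F" by (auto dest: F.in_arcsD1 F.in_arcsD2)
    then have "inj_on (map_prod g g) (parcs F)"
      using map_prod_inj_on[OF g(1) g(1)] by (rule inj_on_subset[rotated])
    then have iso: "pre_digraph.digraph_isomorphism (with_proj F) h"
      using g(1) F.wf_digraph by (auto simp: h_def pre_digraph.digraph_isomorphism_def)
    have "subgraph (app_iso h (with_proj F)) (with_proj G)"
      using g F.wf_digraphI_app_iso[of h] iso G.wf_digraph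
      by (auto simp: subgraph_def compatible_def h_def)
    with iso show ?L by (auto simp: digraph_iso_def)
  qed
  then show ?thesis by (simp add: digraph_free_def)
qed

text \<open>A copy yields two walks with common ends whose inner vertices of equal index differ.
  Excluding this for all pairs of walks, injective or not, excludes the copy.\<close>

lemma C_digraph_freeI:
  assumes l: "l \<ge> 2" and G: "pair_wf_digraph G"
    and meet: "\<And>p q. \<lbrakk>\<And>i. i < l \<Longrightarrow> (p i, p (Suc i)) \<in> parcs G;
      \<And>i. i < l \<Longrightarrow> (q i, q (Suc i)) \<in> parcs G; p 0 = q 0; p l = q l\<rbrakk>
      \<Longrightarrow> \<exists>i. 0 < i \<and> i < l \<and> p i = q i"
  shows "digraph_free (C_digraph l) G"
proof -
  interpret C: pair_digraph "C_digraph l" using l by (rule pair_digraph_C_digraph)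
  have False if g: "inj_on g (pverts (C_digraph l))"
    and hom: "\<forall>u v. (u, v) \<in> parcs (C_digraph l) \<longrightarrow> (g u, g v) \<in> parcs G" for g
  proof -
    have arc: "(g (C_vertex l j i), g (C_vertex l j (Suc i))) \<in> parcs G" if "j < 2" "i < l" for i j
      using hom that by (force simp: C_digraph_def)
    have "\<exists>i. 0 < i \<and> i < l \<and> g (C_vertex l 0 i) = g (C_vertex l 1 i)"
      by (rule meet) (auto intro: arc simp: C_vertex_def[of l _ 0] C_vertex_def[of l _ l])
    then obtain i where i: "0 < i" "i < l" "g (C_vertex l 0 i) = g (C_vertex l 1 i)" by blast
    moreover have "C_vertex l 0 i \<in> pverts (C_digraph l)" "C_vertex l 1 i \<in> pverts (C_digraph l)"
      using i l by (auto simp: pverts_C_digraph C_vertex_def)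
    ultimately have "C_vertex l 0 i = C_vertex l 1 i" using g by (auto dest: inj_onD)
    then show False using i by (auto simp: C_vertex_def)
  qed
  then show ?thesis
    using digraph_free_iff[OF C.pair_wf_digraph_axioms G] by blast
qed

lemma C_digraph_not_freeI:
  assumes l: "l \<ge> 2" and G: "pair_wf_digraph G"
    and p: "\<And>i. i < l \<Longrightarrow> (p i, p (Suc i)) \<in> parcs G" "inj_on p {..l}"
    and q: "\<And>i. i < l \<Longrightarrow> (q i, q (Suc i)) \<in> parcs G" "inj_on q {..l}"
    and ends: "p 0 = q 0" "p l = q l"
    and disj: "\<And>i i'. \<lbrakk>i \<le> l; 0 < i'; i' < l\<rbrakk> \<Longrightarrow> p i \<noteq> q i'"
  shows "\<not> digraph_free (C_digraph l) G"
proof -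
  interpret C: pair_digraph "C_digraph l" using l by (rule pair_digraph_C_digraph)
  interpret G: pair_wf_digraph G by fact
  \<comment> \<open>Vertices up to \<open>l\<close> form the first path; \<open>l + i\<close> is
    inner vertex \<open>i\<close> of the second.\<close>
  define g where "g v = (if v \<le> l then p v else q (v - l))" for v
  have g0: "g (C_vertex l 0 i) = p i" and g1: "g (C_vertex l 1 i) = q i" if "i \<le> l" for i
    using that ends by (auto simp: g_def C_vertex_def)
  have arcs: "(g u, g v) \<in> parcs G" if uv: "(u, v) \<in> parcs (C_digraph l)" for u v
  proof -
    obtain j i where ji: "j < 2" "i < l" "u = C_vertex l j i" "v = C_vertex l j (Suc i)"
      using uv by (auto simp: C_digraph_def)
    then have "j = 0 \<or> j = 1" by auto
    then show ?thesis using ji g0[of i] g0[of "Suc i"] g1[of i] g1[of "Suc i"] p(1) q(1) by auto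
  qed
  have mem: "p i \<in> pverts G \<and> q i \<in> pverts G" if "i \<le> l" for i
  proof (cases "i = l")
    case True
    with p(1)[of "l - 1"] q(1)[of "l - 1"] l show ?thesis by (auto dest: G.in_arcsD2)
  next
    case False
    with p(1)[of i] q(1)[of i] that show ?thesis by (auto dest: G.in_arcsD1)
  qed
  have "inj_on g {..<2 * l}"
  proof (rule inj_onI)
    fix u v assume uv: "u \<in> {..<2 * l}" "v \<in> {..<2 * l}" "g u = g v"
    have 1: "p u = p v \<Longrightarrow> u \<le> l \<Longrightarrow> v \<le> l \<Longrightarrow> u = v" using p(2) by (auto dest: inj_onD)
    have 2: "q (u - l) = q (v - l) \<Longrightarrow> \<not> u \<le> l \<Longrightarrow> \<not> v \<le> l \<Longrightarrow> u = v"
      using inj_onD[OF q(2), of "u - l" "v - l"] uv(1,2) by (simp add: eq_diff_iff)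
    show "u = v"
      using uv 1 2 disj[of u "v - l"] disj[of v "u - l"]
      by (auto simp: g_def less_diff_conv2 split: if_splits)
  qed
  moreover have "g ` {..<2 * l} \<subseteq> pverts G" using mem by (auto simp: g_def)
  ultimately show ?thesis
    using arcs digraph_free_iff[OF C.pair_wf_digraph_axioms G]
    unfolding pverts_C_digraph[OF l] by blast
qed

lemma out_degree_with_proj: "out_degree (with_proj G) u = card {v. (u, v) \<in> parcs G}"
proof -
  have "out_arcs (with_proj G) u = Pair u ` {v. (u, v) \<in> parcs G}" by force
  then show ?thesis by (simp add: out_degree_def card_image inj_on_def)
qed

lemma in_degree_with_proj: "in_degree (with_proj G) v = card {u. (u, v) \<in> parcs G}"
proof -
  have "in_arcs (with_proj G) v = (\<lambda>u. (u, v)) ` {u. (u, v) \<in> parcs G}" by force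
  then show ?thesis by (simp add: in_degree_def card_image inj_on_def)
qed

section \<open>Upper bound\<close>

text \<open>
  Truncated subtraction makes vertex \<open>0\<close> the parent of \<open>1, \<dots>, t\<close>; thus \<open>f\<close> is a spider with \<open>t\<close>
  legs, grown level by level.
\<close>
lemma exists_spider:
  assumes G: "pair_digraph G" and x: "x \<in> pverts G" and t: "t \<ge> 1"
    and deg: "\<And>v. v \<in> pverts G \<Longrightarrow> N < card {w. (v, w) \<in> parcs G}"
  shows "\<exists>f. inj_on f {..N} \<and> f ` {..N} \<subseteq> pverts G \<and>
    (\<forall>s. 0 < s \<and> s \<le> N \<longrightarrow> (f (s - t), f s) \<in> parcs G)"
  using deg
proof (induction N)
  case 0
  then show ?case using x by (intro exI[of _ "\<lambda>_. x"]) auto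
next
  case (Suc N)
  interpret G: pair_digraph G by fact
  obtain f where f: "inj_on f {..N}" "f ` {..N} \<subseteq> pverts G"
    "\<And>s. \<lbrakk>0 < s; s \<le> N\<rbrakk> \<Longrightarrow> (f (s - t), f s) \<in> parcs G"
    using Suc.IH Suc.prems by (meson Suc_lessD)
  let ?u = "f (Suc N - t)"
  have u: "?u \<in> pverts G" using f(2) t by auto
  \<comment> \<open>The parent has more than \<open>Suc N\<close> outneighbours, and only
    \<open>Suc N\<close> vertices are occupied.\<close>
  have "\<not> {w. (?u, w) \<in> parcs G} \<subseteq> f ` {..N}"
  proof
    assume "{w. (?u, w) \<in> parcs G} \<subseteq> f ` {..N}"
    then have "card {w. (?u, w) \<in> parcs G} \<le> card (f ` {..N})" by (intro card_mono) auto
    also have "\<dots> = Suc N" using f(1) by (simp add: card_image)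
    finally show False using Suc.prems[OF u] by simp
  qed
  then obtain w where w: "(?u, w) \<in> parcs G" "w \<notin> f ` {..N}" by blast
  define g where "g = f(Suc N := w)"
  have "inj_on g {..Suc N}"
    using f(1) w(2) by (auto simp: g_def atMost_Suc inj_on_fun_updI)
  moreover have "g ` {..Suc N} \<subseteq> pverts G"
    using f(2) w(1) by (auto simp: g_def atMost_Suc dest: G.in_arcsD2)
  moreover have "(g (s - t), g s) \<in> parcs G" if "0 < s" "s \<le> Suc N" for s
    using f(3)[of s] that t w(1) by (auto simp: g_def le_Suc_eq)
  ultimately show ?case by blast
qed

text \<open>The spider has \<open>Suc (t * (l - 1))\<close> vertices, so every leaf keeps at least
  \<open>d - Suc (t * (l - 1))\<close> outneighbours outside it. For distinct legs these sets are
  disjoint, and their union lies in \<open>pverts G\<close>.\<close>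

lemma C_digraph_free_out_degree_bound:
  assumes l: "l \<ge> 2" and G: "pair_digraph G" and free: "digraph_free (C_digraph l) G"
    and ne: "pverts G \<noteq> {}" and t: "t \<ge> 1"
    and deg: "\<And>v. v \<in> pverts G \<Longrightarrow> d \<le> card {w. (v, w) \<in> parcs G}"
    and d: "t * (l - 1) < d"
  shows "t * (d - Suc (t * (l - 1))) \<le> card (pverts G)"
proof -
  interpret G: pair_digraph G by fact
  define N where "N = t * (l - 1)"
  obtain x where x: "x \<in> pverts G" using ne by blast
  have degN: "N < card {w. (v, w) \<in> parcs G}" if "v \<in> pverts G" for v
    using deg[OF that] d by (simp add: N_def)
  obtain f where f: "inj_on f {..N}" "f ` {..N} \<subseteq> pverts G"
    "\<And>s. \<lbrakk>0 < s; s \<le> N\<rbrakk> \<Longrightarrow> (f (s - t), f s) \<in> parcs G"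
    using exists_spider[OF G x t degN] by blast
  \<comment> \<open>Position of vertex \<open>i\<close> of leg \<open>j\<close> in the numbering of
    the spider: the centre is \<open>0\<close>, and level \<open>i > 0\<close> fills the block from
    \<open>(i - 1) * t + 1\<close> to \<open>i * t\<close>.\<close>
  define idx where "idx j i = (if i = 0 then 0 else (i - 1) * t + j)" for j i
  have idx_le: "idx j i \<le> N" if "j \<in> {1..t}" "i < l" for i j
  proof (cases "i = 0")
    case False
    then have "idx j i \<le> (i - 1) * t + t" using that by (simp add: idx_def)
    also have "\<dots> = t * i" using False by (cases i) auto
    also have "\<dots> \<le> N" unfolding N_def using that by (intro mult_left_mono) auto
    finally show ?thesis .
  qed (simp add: idx_def)
  have idx_eq: "i = i' \<and> (i = 0 \<or> j = j')"
    if "idx j i = idx j' i'" "j \<in> {1..t}" "j' \<in> {1..t}" for i i' j j'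
  proof (cases "i = 0 \<or> i' = 0")
    case True
    then show ?thesis using that by (auto simp: idx_def split: if_splits)
  next
    case False
    \<comment> \<open>Shifting the leg number to \<open>j - 1 < t\<close> turns level and leg into
      quotient and remainder modulo \<open>t\<close>.\<close>
    then have "(i - 1) * t + (j - 1) = (i' - 1) * t + (j' - 1)" (is "?a = ?b")
      using that by (auto simp: idx_def)
    moreover have "j - 1 < t" "j' - 1 < t" using that by auto
    then have "?a div t = i - 1" "?b div t = i' - 1" "?a mod t = j - 1" "?b mod t = j' - 1"
      using t by (simp_all del: One_nat_def)
    ultimately have "i - 1 = i' - 1" "j - 1 = j' - 1" by metis+
    then show ?thesis using False that by auto
  qed
  define A where "A j = {w. (f (idx j (l - 1)), w) \<in> parcs G} - f ` {..N}" for j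
  have Asub: "A j \<subseteq> pverts G" for j by (auto simp: A_def dest: G.in_arcsD2)
  have fin: "finite (A j)" for j using Asub finite_subset G.pair_finite_verts by blast
  have cardA: "d - Suc N \<le> card (A j)" if j: "j \<in> {1..t}" for j
  proof -
    have "f (idx j (l - 1)) \<in> pverts G" using f(2) idx_le[OF j, of "l - 1"] l by auto
    then have "d \<le> card {w. (f (idx j (l - 1)), w) \<in> parcs G}" by (rule deg)
    moreover have "card (f ` {..N}) = Suc N" using f(1) by (simp add: card_image)
    moreover have "card {w. (f (idx j (l - 1)), w) \<in> parcs G} - card (f ` {..N}) \<le> card (A j)"
      unfolding A_def by (rule diff_card_le_card_Diff) simp
    ultimately show ?thesis by linarith
  qed
  have disj: "A j \<inter> A j' = {}" if j: "j \<in> {1..t}" "j' \<in> {1..t}" "j \<noteq> j'" for j j'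
  proof (rule ccontr)
    assume "A j \<inter> A j' \<noteq> {}"
    then obtain y where y: "y \<in> A j" "y \<in> A j'" by blast
    \<comment> \<open>Leg \<open>a\<close> followed by \<open>y\<close> in position
      \<open>l\<close>; for \<open>j\<close> and \<open>j'\<close> this gives the two paths of the
      copy.\<close>
    define P where "P a i = (if i = l then y else f (idx a i))" for a i
    have yN: "f (idx a i) \<noteq> y" if "a \<in> {1..t}" "i < l" for a i
      using y(1) idx_le[OF that] by (auto simp: A_def)
    have arc: "(P a i, P a (Suc i)) \<in> parcs G" if "a \<in> {1..t}" "y \<in> A a" "i < l" for a i
    proof (cases "Suc i = l")
      case True
      then show ?thesis using that by (auto simp: P_def A_def)
    next
      case False
      \<comment> \<open>For \<open>i = 0\<close> the subtraction truncates: \<open>a <= t\<close>,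
        hence \<open>a - t\<close> is the centre \<open>0\<close>.\<close>
      have "idx a (Suc i) - t = idx a i" "0 < idx a (Suc i)"
        using that by (cases i; auto simp: idx_def)+
      then show ?thesis
        using f(3)[of "idx a (Suc i)"] idx_le[OF that(1), of "Suc i"] that False
        by (auto simp: P_def)
    qed
    \<comment> \<open>The case \<open>a = b\<close> gives injectivity of each path, the case of
      distinct legs gives disjointness away from the ends.\<close>
    have P_eq: "i = i' \<and> (i = 0 \<or> i = l \<or> a = b)"
      if "P a i = P b i'" "a \<in> {1..t}" "b \<in> {1..t}" "i \<le> l" "i' \<le> l" for a b i i'
    proof (cases "i = l \<or> i' = l")
      case True
      then show ?thesis using that yN[of a i] yN[of b i']
        by (auto simp: P_def split: if_splits)
    next
      case False
      then have "f (idx a i) = f (idx b i')" using that by (simp add: P_def)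
      then have "idx a i = idx b i'"
        using f(1) idx_le[of a i] idx_le[of b i'] that False by (auto dest: inj_onD)
      then show ?thesis using idx_eq[of a i b i'] that by blast
    qed
    have "\<not> digraph_free (C_digraph l) G"
    proof (rule C_digraph_not_freeI[OF l G.pair_wf_digraph_axioms, of "P j" "P j'"])
      show "P j 0 = P j' 0" "P j l = P j' l" using l by (auto simp: P_def idx_def)
      show "P j i \<noteq> P j' i'" if "i \<le> l" "0 < i'" "i' < l" for i i'
        using P_eq[of j i j' i'] that j by auto
      show "inj_on (P j) {..l}" "inj_on (P j') {..l}" using P_eq j by (auto intro!: inj_onI)
    qed (use arc y j in auto)
    with free show False by contradiction
  qed
  have "t * (d - Suc N) = (\<Sum>j\<in>{1..t}. d - Suc N)" by simp
  also have "\<dots> \<le> (\<Sum>j\<in>{1..t}. card (A j))" using cardA by (intro sum_mono)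
  also have "\<dots> = card (\<Union>j\<in>{1..t}. A j)"
    using fin disj by (intro card_UN_disjoint[symmetric]) auto
  also have "\<dots> \<le> card (pverts G)"
    using Asub G.pair_finite_verts by (intro card_mono) auto
  finally show ?thesis by (simp add: N_def)
qed

text \<open>With \<open>t\<close> the ceiling of \<open>sqrt n\<close>, the rounding is absorbed by
  \<open>t <= 2 * sqrt n\<close>, so the bound holds for all \<open>n >= 1\<close> without an error
  term.\<close>

lemma min_outdegree_C_digraph_free_le:
  assumes l: "l \<ge> 2" and n: "n \<ge> 1" and G: "G \<in> free_digraphs n (C_digraph l)"
  shows "real (min_outdegree G) \<le> 2 * real l * sqrt (real n)"
proof (rule ccontr)
  assume "\<not> ?thesis"
  then have big: "2 * real l * sqrt (real n) < real (min_outdegree G)" (is "_ < real ?d") by simp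
  have G': "pair_digraph G" "card (pverts G) = n" "digraph_free (C_digraph l) G"
    using G by (auto simp: free_digraphs_def)
  interpret G: pair_digraph G by fact
  have ne: "pverts G \<noteq> {}" using G'(2) n by auto
  define s where "s = sqrt (real n)"
  have s: "s \<ge> 1" "s * s = real n" using n by (auto simp: s_def)
  define t where "t = nat \<lceil>s\<rceil>"
  have t: "s \<le> real t" "real t \<le> s + 1" "t \<ge> 1" using s(1) unfolding t_def by linarith+
  have deg: "?d \<le> card {w. (v, w) \<in> parcs G}" if "v \<in> pverts G" for v
    unfolding min_outdegree_def out_degree_with_proj[symmetric]
    using that G.pair_finite_verts by (intro Min_le) auto
  have "real (t * (l - 1)) \<le> (2 * s) * (real l - 1)"
    using t(2) s(1) l by (auto simp: of_nat_diff intro!: mult_right_mono)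
  then have gap: "real (t * (l - 1)) + 2 * s < real ?d"
    using big by (simp add: s_def[symmetric] algebra_simps)
  then have lt: "t * (l - 1) < ?d" using s(1) by linarith
  have "real (t * (?d - Suc (t * (l - 1)))) \<le> real n"
    using C_digraph_free_out_degree_bound[OF l G'(1,3) ne t(3) deg lt] G'(2)
    by (simp only: of_nat_le_iff)
  \<comment> \<open>Of the surplus \<open>2 * s\<close>, the centre of the spider costs 1, which is
    at most \<open>s\<close>.\<close>
  moreover have "s < real (?d - Suc (t * (l - 1)))" using gap lt s(1) by linarith
  then have "s * s < real t * real (?d - Suc (t * (l - 1)))"
    using t(1) s(1) by (intro mult_le_less_imp_less) (auto simp del: of_nat_diff)
  ultimately show False using s(2) by simp
qed

section \<open>Lower bound\<close>

text \<open>
  The grid has \<open>m\<close> rows and \<open>m\<close> columns; the cells \<open>0, 1, 2, \<dots>\<close> fill it diagonal after diagonal,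
  so that every initial segment meets all rows and columns almost equally often. The row of a
  cell is selected by \<open>True\<close> and its column by \<open>False\<close>.
\<close>
definition grid_coord :: "nat \<Rightarrow> bool \<Rightarrow> nat \<Rightarrow> nat" where
  "grid_coord m b w = (if b then w mod m else (w div m + w) mod m)"

text \<open>Vertex \<open>u\<close> encodes cell \<open>u div k\<close> of layer
  \<open>u mod k\<close>. Taking residues as layers fills them evenly for every \<open>n\<close>,
  without divisibility assumptions.\<close>

definition grid_digraph :: "nat \<Rightarrow> nat \<Rightarrow> nat \<Rightarrow> nat pair_pre_digraph" where
  "grid_digraph l m n = (let k = 2 * (l - 1) in
     \<lparr> pverts = {..<n},
       parcs = {(u, v). u < n \<and> v < n \<and> v mod k = Suc u mod k \<and>
         grid_coord m (u mod k < l - 1) (u div k) = grid_coord m (u mod k < l - 1) (v div k)} \<rparr>)"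

text \<open>The row gives \<open>w mod m\<close>; subtracting it from the column modulo
  \<open>m\<close> leaves \<open>w div m\<close>, which is below \<open>m\<close>.\<close>

lemma grid_coord_inj:
  assumes "\<And>b. grid_coord m b w = grid_coord m b w'" "w < m * m" "w' < m * m"
  shows "w = w'"
proof -
  have r: "w mod m = w' mod m" using assms(1)[of True] by (simp add: grid_coord_def)
  have "(w div m + w mod m) mod m = (w' div m + w' mod m) mod m"
    using assms(1)[of False] by (simp add: grid_coord_def mod_simps)
  then have "w div m mod m = w' div m mod m"
    using r cong_add_rcancel_nat[of "w div m" "w mod m" "w' div m" m] by (simp add: cong_def)
  moreover have "w div m < m" "w' div m < m"
    using assms(2,3) by (auto simp: less_mult_imp_div_less)
  ultimately have "w div m = w' div m" by simp
  with r show ?thesis by (metis div_mult_mod_eq)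
qed

text \<open>Each complete block of \<open>m\<close> consecutive cells, those with a fixed
  \<open>w div m\<close>, meets every row and every column.\<close>

lemma card_grid_line:
  assumes m: "0 < m" and r: "r < m"
  shows "W div m \<le> card {w. w < W \<and> grid_coord m b w = r}"
proof -
  \<comment> \<open>The cell of block \<open>d\<close> on the given line. For a column its offset is
    \<open>r - d\<close> modulo \<open>m\<close>; \<open>(m - 1) * d\<close> replaces
    \<open>- d\<close> to stay within the naturals.\<close>
  define h where "h d = m * d + (if b then r else (r + (m - 1) * d) mod m)" for d
  have lt: "(if b then r else (r + (m - 1) * d) mod m) < m" for d using m r by simp
  have hdiv: "h d div m = d" for d using lt[of d] m by (simp add: h_def)
  have "h d < W \<and> grid_coord m b (h d) = r" if d: "d < W div m" for d
  proof
    have "h d < m * Suc d" using lt[of d] by (simp add: h_def)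
    also have "\<dots> \<le> m * (W div m)" using d by (intro mult_left_mono) auto
    also have "\<dots> \<le> W" by simp
    finally show "h d < W" .
    show "grid_coord m b (h d) = r"
    proof (cases b)
      case True
      then show ?thesis using r by (simp add: grid_coord_def h_def)
    next
      case False
      then have "grid_coord m b (h d) = ((d + m * d) + (r + (m - 1) * d) mod m) mod m"
        using hdiv[of d] by (simp add: grid_coord_def) (simp add: h_def add.assoc)
      also have "\<dots> = ((d + m * d) + (r + (m - 1) * d)) mod m" by (rule mod_add_right_eq)
      also have "(d + m * d) + (r + (m - 1) * d) = r + m * (2 * d)"
        using m by (cases m) (simp_all add: algebra_simps)
      finally show ?thesis using r by simp
    qed
  qed
  then have "h ` {..<W div m} \<subseteq> {w. w < W \<and> grid_coord m b w = r}" by auto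
  then have "card (h ` {..<W div m}) \<le> card {w. w < W \<and> grid_coord m b w = r}"
    by (intro card_mono) auto
  moreover have "inj_on h {..<W div m}" by (metis hdiv inj_onI)
  ultimately show ?thesis by (simp add: card_image)
qed

text \<open>Cells below \<open>n div k\<close> are present in every layer, since
  \<open>k * w + c < k * Suc w <= n\<close>.\<close>

lemma card_grid_line_in_layer:
  assumes "0 < m" "r < m" "c < k"
  shows "n div k div m \<le> card {v. v < n \<and> v mod k = c \<and> grid_coord m b (v div k) = r}"
proof -
  let ?L = "{w. w < n div k \<and> grid_coord m b w = r}"
  have "(\<lambda>w. k * w + c) ` ?L \<subseteq> {v. v < n \<and> v mod k = c \<and> grid_coord m b (v div k) = r}"
  proof (rule image_subsetI)
    fix w assume w: "w \<in> ?L"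
    then have "k * Suc w \<le> k * (n div k)" by (intro mult_left_mono) auto
    also have "\<dots> \<le> n" by simp
    finally have "k * w + c < n" using assms by simp
    then show "k * w + c \<in> {v. v < n \<and> v mod k = c \<and> grid_coord m b (v div k) = r}"
      using assms w by simp
  qed
  then have "card ((\<lambda>w. k * w + c) ` ?L)
      \<le> card {v. v < n \<and> v mod k = c \<and> grid_coord m b (v div k) = r}"
    by (intro card_mono) auto
  moreover have "inj_on (\<lambda>w. k * w + c) ?L" using assms by (auto simp: inj_on_def)
  ultimately show ?thesis
    using card_grid_line[of m r "n div k" b] assms by (simp add: card_image)
qed

lemma grid_coord_less: "0 < m \<Longrightarrow> grid_coord m b w < m"
  by (simp add: grid_coord_def)

lemma pair_digraph_grid_digraph:
  assumes "l \<ge> 2"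
  shows "pair_digraph (grid_digraph l m n)"
proof -
  have "parcs (grid_digraph l m n) \<subseteq> {..<n} \<times> {..<n}" by (auto simp: grid_digraph_def Let_def)
  then have "finite (parcs (grid_digraph l m n))" by (rule finite_subset) simp
  moreover have "u mod (2 * (l - 1)) \<noteq> Suc u mod (2 * (l - 1))" for u
    using assms by (auto simp: mod_Suc)
  ultimately show ?thesis
    by unfold_locales (auto simp: grid_digraph_def Let_def simp del: One_nat_def)
qed

text \<open>The outneighbours of a vertex form a line of the next layer, and its inneighbours
  contain a line of the previous layer.\<close>

lemma min_semidegree_grid_digraph_ge:
  assumes l: "l \<ge> 2" and m: "0 < m" and n: "n \<ge> 1"
  shows "n div (2 * (l - 1)) div m \<le> min_semidegree (grid_digraph l m n)"
proof -
  let ?k = "2 * (l - 1)" and ?G = "grid_digraph l m n"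
  have k: "0 < ?k" using l by simp
  have "n div ?k div m \<le> out_degree (with_proj ?G) u" if u: "u < n" for u
  proof -
    let ?b = "u mod ?k < l - 1"
    have "{v. (u, v) \<in> parcs ?G} = {v. v < n \<and> v mod ?k = Suc u mod ?k \<and>
        grid_coord m ?b (v div ?k) = grid_coord m ?b (u div ?k)}"
      using u by (auto simp: grid_digraph_def Let_def)
    then show ?thesis
      using card_grid_line_in_layer[OF m grid_coord_less[OF m], of "Suc u mod ?k" ?k] k
      by (simp add: out_degree_with_proj)
  qed
  moreover have "n div ?k div m \<le> in_degree (with_proj ?G) v" if v: "v < n" for v
  proof -
    \<comment> \<open>The layer before that of \<open>v\<close>, with \<open>?k - 1\<close> added in
      place of subtracting 1; its type decides which coordinate the arcs into \<open>v\<close>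
      keep.\<close>
    define c where "c = (v + (?k - 1)) mod ?k"
    let ?b = "c < l - 1"
    have c: "c < ?k" "Suc c mod ?k = v mod ?k" using k by (auto simp: c_def mod_Suc_eq)
    have "{u. u < n \<and> u mod ?k = c \<and> grid_coord m ?b (u div ?k) = grid_coord m ?b (v div ?k)}
        \<subseteq> {u. (u, v) \<in> parcs ?G}"
      using v c by (auto simp: grid_digraph_def Let_def mod_Suc_eq)
    then have "card {u. u < n \<and> u mod ?k = c \<and>
        grid_coord m ?b (u div ?k) = grid_coord m ?b (v div ?k)} \<le> card {u. (u, v) \<in> parcs ?G}"
      by (intro card_mono) (auto simp: grid_digraph_def Let_def)
    then show ?thesis
      using card_grid_line_in_layer[OF m grid_coord_less[OF m] c(1), of n ?b ?b "v div ?k"]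
      by (simp add: in_degree_with_proj)
  qed
  moreover have "pverts ?G = {..<n}" by (simp add: grid_digraph_def Let_def)
  moreover have "{..<n} \<noteq> {}" using n by (simp add: lessThan_empty_iff)
  ultimately show ?thesis
    by (auto simp: min_semidegree_def min_outdegree_def min_indegree_def)
qed

text \<open>The bound on \<open>n\<close> keeps cell numbers below \<open>m * m\<close>, where the
  two coordinates determine the cell. Hence two walks with common ends coincide where the type
  changes.\<close>

lemma digraph_free_grid_digraph:
  assumes l: "l \<ge> 2" and nm: "n \<le> 2 * (l - 1) * (m * m)"
  shows "digraph_free (C_digraph l) (grid_digraph l m n)"
proof (rule C_digraph_freeI[OF l])
  interpret pair_digraph "grid_digraph l m n" using l by (rule pair_digraph_grid_digraph)
  show "pair_wf_digraph (grid_digraph l m n)" by (rule pair_wf_digraph_axioms)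
next
  let ?k = "2 * (l - 1)" and ?G = "grid_digraph l m n"
  fix p q
  assume p: "\<And>i. i < l \<Longrightarrow> (p i, p (Suc i)) \<in> parcs ?G"
    and q: "\<And>i. i < l \<Longrightarrow> (q i, q (Suc i)) \<in> parcs ?G"
    and ends: "p 0 = q 0" "p l = q l"
  define c where "c = p 0 mod ?k"
  define b where "b \<longleftrightarrow> c < l - 1"
  \<comment> \<open>The number of steps from layer \<open>c\<close> to the first layer of the other
    type, which is layer \<open>l - 1\<close> or layer \<open>0\<close>.\<close>
  define j where "j = (if b then l - 1 - c else 2 * (l - 1) - c)"
  have c: "c < ?k" using l by (simp add: c_def)
  have j: "0 < j" "j < l" using c l by (auto simp: j_def b_def)
  have type_before: "(c + i) mod ?k < l - 1 \<longleftrightarrow> b" if "i < j" for i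
    using that c by (auto simp: j_def b_def split: if_splits)
  \<comment> \<open>At most \<open>l - 1\<close> arcs remain after step \<open>j\<close>, and
    \<open>l - 1\<close> consecutive layers share a type, so the type does not change again.\<close>
  have type_after: "(c + i) mod ?k < l - 1 \<longleftrightarrow> \<not> b" if "j \<le> i" "i < l" for i
  proof (cases b)
    case True
    then show ?thesis using that c by (auto simp: j_def b_def)
  next
    case False
    then have "?k \<le> c + i" "c + i - ?k < ?k" using that c by (auto simp: j_def)
    then have "(c + i) mod ?k = c + i - ?k" by (metis le_mod_geq mod_less)
    moreover have "c + i - ?k < l - 1" using that c by linarith
    ultimately show ?thesis using False by simp
  qed
  have walk: "w i mod ?k = (c + i) mod ?k \<and> w i < n \<and>
      (i \<le> j \<longrightarrow> grid_coord m b (w i div ?k) = grid_coord m b (w 0 div ?k)) \<and>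
      (j \<le> i \<longrightarrow> grid_coord m (\<not> b) (w i div ?k) = grid_coord m (\<not> b) (w j div ?k))"
    if w: "\<And>i. i < l \<Longrightarrow> (w i, w (Suc i)) \<in> parcs ?G" "w 0 mod ?k = c" "i \<le> l" for w i
    using that(3)
  proof (induction i)
    case 0
    then show ?case using w(1)[of 0] w(2) j c by (auto simp: grid_digraph_def Let_def)
  next
    case (Suc i)
    have arc: "w (Suc i) < n" "w (Suc i) mod ?k = Suc (w i) mod ?k"
      "grid_coord m (w i mod ?k < l - 1) (w i div ?k) =
       grid_coord m (w i mod ?k < l - 1) (w (Suc i) div ?k)"
      using w(1)[of i] Suc.prems by (auto simp: grid_digraph_def Let_def)
    have IH: "w i mod ?k = (c + i) mod ?k"
      "i \<le> j \<Longrightarrow> grid_coord m b (w i div ?k) = grid_coord m b (w 0 div ?k)"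
      "j \<le> i \<Longrightarrow> grid_coord m (\<not> b) (w i div ?k) = grid_coord m (\<not> b) (w j div ?k)"
      using Suc by auto
    have "w (Suc i) mod ?k = (c + Suc i) mod ?k"
      using arc(2) IH(1) by (metis add_Suc_right mod_Suc_eq)
    moreover have "grid_coord m b (w (Suc i) div ?k) = grid_coord m b (w 0 div ?k)"
      if "Suc i \<le> j"
      using arc(3) IH(1,2) type_before[of i] that by simp
    moreover have "grid_coord m (\<not> b) (w (Suc i) div ?k) = grid_coord m (\<not> b) (w j div ?k)"
      if "j \<le> Suc i"
    proof (cases "Suc i = j")
      case False
      then show ?thesis using arc(3) IH(1,3) type_after[of i] that Suc.prems by simp
    qed simp
    ultimately show ?case using arc(1) by blast
  qed
  note P = walk[of p, OF p c_def[symmetric]]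
  have q0: "q 0 mod ?k = c" using ends(1) by (simp add: c_def)
  note Q = walk[of q, OF q q0]
  \<comment> \<open>The coordinate \<open>b\<close> is carried forward from the common start, the
    other one back from the common end.\<close>
  have "grid_coord m b (p j div ?k) = grid_coord m b (q j div ?k)"
    using P[of j] Q[of j] j ends(1) by simp
  moreover have "grid_coord m (\<not> b) (p j div ?k) = grid_coord m (\<not> b) (q j div ?k)"
    using P[of l] Q[of l] j ends(2) by simp
  ultimately have "grid_coord m b' (p j div ?k) = grid_coord m b' (q j div ?k)" for b'
    by (cases "b' = b") auto
  moreover have "p j div ?k < m * m" "q j div ?k < m * m"
    using P[of j] Q[of j] j nm by (auto intro!: less_mult_imp_div_less simp: mult.commute)
  ultimately have "p j div ?k = q j div ?k" by (rule grid_coord_inj)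
  moreover have "p j mod ?k = q j mod ?k" using P[of j] Q[of j] j by simp
  ultimately have "p j = q j" by (metis div_mult_mod_eq)
  with j show "\<exists>i. 0 < i \<and> i < l \<and> p i = q i" by blast
qed

section \<open>Choice of the grid size and the asymptotic bounds\<close>

lemma real_div_nat_ge: "real (a div b) \<ge> real a / real b - 1"
  using floor_divide_of_nat_eq[where 'a = real, of a b] by linarith

text \<open>The grid needs \<open>m * m >= n / k\<close>, while the guaranteed degree is about
  \<open>n / (k * m)\<close>, so \<open>m\<close> is taken just above
  \<open>s = sqrt (n / k)\<close>.\<close>

lemma m_zero_C_digraph_ge:
  assumes l: "l \<ge> 2" and n: "n \<ge> 1"
  shows "sqrt (real n / (2 * real l - 2)) - 2 \<le> real (m_zero n (C_digraph l))"
proof -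
  define k where "k = 2 * (l - 1)"
  have k: "0 < k" "real k = 2 * real l - 2" using l by (auto simp: k_def of_nat_diff)
  define s where "s = sqrt (real n / real k)"
  have s: "s \<ge> 0" "s * s = real n / real k" by (auto simp: s_def)
  define m where "m = nat \<lfloor>s\<rfloor> + 1"
  have m: "0 < m" "s \<le> real m" "real m \<le> s + 1" using s(1) unfolding m_def by linarith+
  have "real n / real k \<le> real m * real m"
    using m(2) s by (metis mult_mono of_nat_0_le_iff)
  then have "real n \<le> real (k * (m * m))" using k(1) by (simp add: field_simps)
  then have nm: "n \<le> k * (m * m)" by (simp only: of_nat_le_iff)
  let ?G = "grid_digraph l m n"
  have "?G \<in> free_digraphs n (C_digraph l)"
    using pair_digraph_grid_digraph[OF l, of m n] digraph_free_grid_digraph[OF l nm[unfolded k_def]]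
    by (simp add: free_digraphs_def grid_digraph_def Let_def)
  then have "min_semidegree ?G \<le> m_zero n (C_digraph l)"
    unfolding m_zero_def using finite_min_degrees(2)[OF n] by (intro Max_ge) auto
  then have "real (n div k div m) \<le> real (m_zero n (C_digraph l))"
    using min_semidegree_grid_digraph_ge[OF l m(1) n] by (simp add: k_def)
  moreover have "s - 2 \<le> real (n div k div m)"
  proof -
    have "real (n div k) \<ge> real n / real k - 1"
      by (rule real_div_nat_ge)
    \<comment> \<open>The first rounding leaves \<open>s * s - 1\<close>, whose factor
      \<open>s + 1\<close> is at least \<open>m\<close>; so division by \<open>m\<close> leaves
      \<open>s - 1\<close>, and the second rounding costs one more.\<close>
    then have "(s - 1) * (s + 1) \<le> real (n div k)" using s(2) by (simp add: algebra_simps)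
    moreover have "(s - 1) * real m \<le> real (n div k)"
    proof (cases "s \<ge> 1")
      case True
      then have "(s - 1) * real m \<le> (s - 1) * (s + 1)" using m(3) by (intro mult_left_mono) auto
      then show ?thesis using calculation by linarith
    next
      case False
      then have "(s - 1) * real m \<le> 0" using m(1) by (simp add: mult_le_0_iff)
      then show ?thesis by (rule order_trans) simp
    qed
    then have "s - 1 \<le> real (n div k) / real m" using m(1) by (simp add: field_simps)
    then show ?thesis using real_div_nat_ge[of "n div k" m] by linarith
  qed
  ultimately show ?thesis using k(2) by (simp add: s_def)
qed

theorem theorem1p13:
  fixes l :: nat
  assumes "l \<ge> 2"
  shows "\<exists>e1 e2 :: nat \<Rightarrow> real. e1 \<in> o(\<lambda>_. 1) \<and> e2 \<in> o(\<lambda>_. 1) \<and>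
    (\<forall>n\<ge>1.
       (1 / sqrt (2 * real l - 2) - e1 n) * sqrt (real n) \<le> real (m_zero n (C_digraph l)) \<and>
       m_zero n (C_digraph l) \<le> m_plus n (C_digraph l) \<and>
       real (m_plus n (C_digraph l)) \<le> (2 * real l + e2 n) * sqrt (real n))"
proof (intro exI conjI allI impI)
  \<comment> \<open>The additive loss 2 in the lower bound becomes \<open>2 / sqrt n\<close> once
    \<open>sqrt n\<close> is factored out; the upper bound has no loss, so its error term is
    \<open>0\<close>.\<close>
  show "(\<lambda>n. 2 / sqrt (real n)) \<in> o(\<lambda>_. 1)"
    using tendsto_divide_0[OF tendsto_const filterlim_at_top_imp_at_infinity[OF
        filterlim_compose[OF sqrt_at_top filterlim_real_sequentially]]]
    by (intro smalloI_tendsto) simp_all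
  show "(\<lambda>_. 0 :: real) \<in> o(\<lambda>_ :: nat. 1)" by simp
next
  fix n :: nat assume n: "n \<ge> 1"
  let ?D = "free_digraphs n (C_digraph l)"
  have ne: "?D \<noteq> {}" using assms by (rule free_digraphs_C_nonempty)
  note fin = finite_min_degrees[OF n, of "C_digraph l"]
  have "(1 / sqrt (2 * real l - 2) - 2 / sqrt (real n)) * sqrt (real n)
      = sqrt (real n / (2 * real l - 2)) - 2"
    using n by (simp add: algebra_simps real_sqrt_divide)
  then show "(1 / sqrt (2 * real l - 2) - 2 / sqrt (real n)) * sqrt (real n)
      \<le> real (m_zero n (C_digraph l))"
    using m_zero_C_digraph_ge[OF assms n] by simp
  show "m_zero n (C_digraph l) \<le> m_plus n (C_digraph l)"
    unfolding m_zero_def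
  proof (rule Max.boundedI)
    fix a assume "a \<in> min_semidegree ` ?D"
    then obtain G where G: "G \<in> ?D" "a = min_semidegree G" by blast
    then have "a \<le> min_outdegree G" by (simp add: min_semidegree_def)
    also have "\<dots> \<le> m_plus n (C_digraph l)"
      unfolding m_plus_def using G fin by (intro Max_ge) auto
    finally show "a \<le> m_plus n (C_digraph l)" .
  qed (use fin ne in auto)
  have "m_plus n (C_digraph l) \<in> min_outdegree ` ?D"
    unfolding m_plus_def using fin ne by (intro Max_in) auto
  then show "real (m_plus n (C_digraph l)) \<le> (2 * real l + 0) * sqrt (real n)"
    using min_outdegree_C_digraph_free_le[OF assms n] by auto
qed

end
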